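(* Let $\{x_n\}_{n\in\mathbb{N}}$ be a strong divisibility sequence with $x_1=1$. Suppose that there exists $\alpha>0$ such that $m_p<p^{\alpha}$ for all but finitely many primes $p$. For $z\geq 2$ put $\Pi_z=\prod_{p<z}p$ (product over primes). Then there is a constant $c>0$, depending on the sequence and $\alpha$, such that for all $z\geq 2$, $$\sum_{d\mid \Pi_z}\frac{\mu(d)}{m_d}\geq \frac{c}{\log z}.$$
   Context: $\mathbb{N}$ denotes the positive integers. A strong divisibility sequence (SDS) is a sequence of positive integers $\{x_n\}_{n\in\mathbb{N}}$ such that $\gcd(x_n,x_m)=x_{\gcd(n,m)}$ for all $m,n\geq 1$. For $d\in\mathbb{N}$, $m_d$ denotes the smallest positive integer such that $d\mid x_{m_d}$; if no such integer exists, $m_d=\infty$, and in this case $\mu(d)/m_d$ is counted as $0$ in the sum. $\mu$ is the Möbius function. *)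

theory Defs
  imports
    "HOL-Analysis.Analysis"
    "HOL-Number_Theory.Number_Theory"
    "HOL-Computational_Algebra.Squarefree"
begin

text \<open>
  Sequences are indexed by the positive integers; they are modelled as functions on \<^typ>\<open>nat\<close>
  whose value at \<open>0\<close> is irrelevant throughout.
\<close>

definition strong_divisibility_sequence :: "(nat \<Rightarrow> nat) \<Rightarrow> bool" where
  "strong_divisibility_sequence x \<longleftrightarrow>
     (\<forall>n\<ge>1. x n > 0) \<and> (\<forall>m\<ge>1. \<forall>n\<ge>1. gcd (x n) (x m) = x (gcd n m))"

text \<open>The rank of apparition \<open>m\<^sub>d\<close> of \<open>d\<close> in the sequence \<open>x\<close>.\<close>

definition apparition_rank :: "(nat \<Rightarrow> nat) \<Rightarrow> nat \<Rightarrow> enat" where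
  "apparition_rank x d =
     (if \<exists>m\<ge>1. d dvd x m then enat (LEAST m. m \<ge> 1 \<and> d dvd x m) else \<infinity>)"

definition moebius_mu :: "nat \<Rightarrow> int" where
  "moebius_mu n = (if squarefree n then (- 1) ^ card (prime_factors n) else 0)"

text \<open>The quotient \<open>\<mu>(d) / m\<^sub>d\<close>, counted as \<open>0\<close> when \<open>m\<^sub>d = \<infinity>\<close>.\<close>

definition moebius_over_rank :: "(nat \<Rightarrow> nat) \<Rightarrow> nat \<Rightarrow> real" where
  "moebius_over_rank x d =
     (case apparition_rank x d of enat m \<Rightarrow> real_of_int (moebius_mu d) / real m | \<infinity> \<Rightarrow> 0)"

definition primorial_below :: "real \<Rightarrow> nat" where
  "primorial_below z = \<Prod>{p :: nat. prime p \<and> real p < z}"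

end

theory Submission
  imports Defs
begin

text \<open>
  Since \<open>d\<close> divides \<open>x n\<close> exactly when \<open>m\<^sub>d\<close> divides \<open>n\<close>, Moebius inversion shows that the sum is the
  density of the \<open>n\<close> for which \<open>x n\<close> is coprime to \<open>\<Pi>\<^sub>z\<close>, that is, of the \<open>n\<close> divisible by no
  \<open>m\<^sub>p\<close> with \<open>p < z\<close>. All finite \<open>m\<^sub>p\<close> exceed \<open>1\<close> (as \<open>x 1 = 1\<close>) and are at most some
  \<open>Y = O(z powr \<alpha>)\<close>, so every \<open>n\<close> without prime factor up to \<open>Y\<close> qualifies. These have density
  \<open>\<Prod>(1 - 1 / p)\<close> over the primes \<open>p \<le> Y\<close>, which is at least a constant over \<open>ln Y\<close> by (the lower
  half of) Mertens' theorem. The latter follows from \<open>\<Sum>\<^bsub>p\<le>n\<^esub> ln p / p \<le> 2 ln n\<close> and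
  \<open>\<zeta>(1 + \<delta>) \<le> 1 + 1 / \<delta>\<close> by comparing the Euler factors at \<open>1\<close> and at \<open>1 + 1 / ln n\<close>.
\<close>


section \<open>A Chebyshev-type bound from the prime factors of factorials\<close>

lemma prod_dvd_of_coprime:
  fixes f :: "'a \<Rightarrow> nat"
  assumes "finite A" "\<And>a. a \<in> A \<Longrightarrow> f a dvd n"
    and "\<And>a b. a \<in> A \<Longrightarrow> b \<in> A \<Longrightarrow> a \<noteq> b \<Longrightarrow> coprime (f a) (f b)"
  shows "(\<Prod>a\<in>A. f a) dvd n"
  using assms
proof (induction A rule: finite_induct)
  case (insert a A)
  then have "coprime (f a) (\<Prod>b\<in>A. f b)"
    by (intro prod_coprime_right) (metis insertCI)
  with insert show ?case by (auto intro!: divides_mult)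
qed simp

text \<open>Each of the multiples p, 2p, ..., kp contributes one factor p.\<close>

lemma prime_power_dvd_fact:
  fixes p :: nat
  assumes "p > 0"
  shows "p ^ k dvd fact (p * k)"
proof (induction k)
  case (Suc k)
  have "p * k \<le> p * Suc k - 1" using assms by simp
  then have "fact (p * k) dvd (fact (p * Suc k - 1) :: nat)" by (rule fact_dvd)
  then have "p * p ^ k dvd p * Suc k * fact (p * Suc k - 1)"
    using Suc.IH by (intro mult_dvd_mono) (auto intro: dvd_trans)
  also have "\<dots> = fact (p * Suc k)" using assms by (subst (2) fact_reduce) auto
  finally show ?case by simp
qed simp

text \<open>The coprime powers \<open>p ^ (n div p)\<close> all divide \<open>fact n\<close>, which
  is at most \<open>n ^ n\<close>; taking logarithms bounds the sum of
  \<open>(n div p) * ln p\<close>. Replacing \<open>n div p\<close> by \<open>n / p\<close> costs at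
  most a factor 2, because \<open>p \<le> n\<close>.\<close>

lemma sum_ln_prime_over_prime_le:
  assumes "n > 0"
  shows "(\<Sum>p | prime p \<and> p \<le> n. ln (real p) / real p) \<le> 2 * ln (real n)"
proof -
  let ?P = "{p. prime p \<and> p \<le> n}"
  have fin: "finite ?P" by (rule finite_subset[of _ "{..n}"]) auto
  have gt0: "p > 0" if "p \<in> ?P" for p using that by (auto intro: prime_gt_0_nat)
  have "(\<Prod>p\<in>?P. p ^ (n div p)) dvd (fact n :: nat)"
  proof (intro prod_dvd_of_coprime fin)
    show "p ^ (n div p) dvd fact n" if "p \<in> ?P" for p
      using prime_power_dvd_fact[of p "n div p"] gt0[OF that]
      by (meson dvd_trans fact_dvd times_div_less_eq_dividend)
    show "coprime (p ^ (n div p)) (q ^ (n div q))" if "p \<in> ?P" "q \<in> ?P" "p \<noteq> q" for p q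
      using that by (simp add: primes_coprime)
  qed
  then have "(\<Prod>p\<in>?P. p ^ (n div p)) \<le> fact n" by (rule dvd_imp_le) simp
  also have "\<dots> \<le> n ^ n" using fact_le_power[of n, where 'a = nat] by simp
  finally have "real (\<Prod>p\<in>?P. p ^ (n div p)) \<le> real (n ^ n)" by (rule of_nat_mono)
  moreover have "real (\<Prod>p\<in>?P. p ^ (n div p)) > 0"
    using gt0 by (auto simp del: of_nat_prod of_nat_power intro!: prod_pos)
  ultimately have "ln (real (\<Prod>p\<in>?P. p ^ (n div p))) \<le> ln (real (n ^ n))"
    by (subst ln_le_cancel_iff) (use assms in auto)
  moreover have "ln (real (\<Prod>p\<in>?P. p ^ (n div p))) = (\<Sum>p\<in>?P. real (n div p) * ln (real p))"
    using fin gt0 by (subst of_nat_prod, subst ln_prod) (auto simp: ln_realpow)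
  ultimately have 1: "(\<Sum>p\<in>?P. real (n div p) * ln (real p)) \<le> real n * ln (real n)"
    using assms by (simp add: ln_realpow)
  have "real n * (ln (real p) / real p) \<le> 2 * (real (n div p) * ln (real p))" if "p \<in> ?P" for p
  proof -
    have "n div p \<ge> 1" using that gt0[OF that] by (simp add: Suc_le_eq div_greater_zero_iff)
    moreover have "n < p * (n div p) + p" using dividend_less_times_div[of p n] gt0[OF that] by simp
    moreover from \<open>n div p \<ge> 1\<close> have "p * 1 \<le> p * (n div p)" by (rule mult_le_mono2)
    ultimately have "n \<le> 2 * (p * (n div p))" by linarith
    then have "real n \<le> 2 * (real p * real (n div p))"
      by (metis of_nat_le_iff of_nat_mult of_nat_numeral)
    then have "real n / real p \<le> 2 * real (n div p)" using gt0[OF that] by (simp add: field_simps)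
    then have "real n / real p * ln (real p) \<le> 2 * real (n div p) * ln (real p)"
      by (rule mult_right_mono) (use gt0[OF that] in simp)
    then show ?thesis by simp
  qed
  then have "real n * (\<Sum>p\<in>?P. ln (real p) / real p) \<le> 2 * (\<Sum>p\<in>?P. real (n div p) * ln (real p))"
    unfolding sum_distrib_left by (rule sum_mono)
  also have "\<dots> \<le> real n * (2 * ln (real n))" using 1 by simp
  finally show ?thesis using assms by simp
qed

section \<open>Zeta near 1 and its finite Euler products\<close>

lemma powr_neg_one_plus:
  fixes y \<delta> :: real
  assumes "y > 0"
  shows "y powr - (1 + \<delta>) = y powr - \<delta> / y"
proof -
  have "- (1 + \<delta>) = - \<delta> - 1" by simp
  then show ?thesis using assms by (simp only: powr_diff powr_one less_imp_le)
qed

text \<open>The right side is the integral of \<delta> t^(-1-\<delta>) over [n, n+1], the left side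
  the least value of the integrand there. The proof needs only ln t \<le> t - 1 and 1 + t \<le> exp
  t.\<close>

lemma powr_telescope_bound:
  fixes \<delta> :: real
  assumes "\<delta> > 0" "n > 0"
  shows "\<delta> * real (Suc n) powr (- (1 + \<delta>)) \<le> real n powr - \<delta> - real (Suc n) powr - \<delta>"
proof -
  let ?N = "real (Suc n)"
  have "ln (real n / ?N) \<le> real n / ?N - 1" using assms by (intro ln_le_minus_one) simp
  also have "\<dots> = - 1 / ?N" by (simp add: field_simps)
  finally have "\<delta> * ln (real n / ?N) \<le> \<delta> * (- 1 / ?N)" using assms(1) by (intro mult_left_mono) auto
  then have "1 + \<delta> / ?N \<le> 1 + - \<delta> * ln (real n / ?N)" by simp
  also have "\<dots> \<le> exp (- \<delta> * ln (real n / ?N))" by (rule exp_ge_add_one_self)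
  also have "\<dots> = (real n / ?N) powr - \<delta>" using assms by (simp add: powr_def)
  also have "\<dots> = real n powr - \<delta> / ?N powr - \<delta>" by (simp add: powr_divide)
  finally have "(1 + \<delta> / ?N) * ?N powr - \<delta> \<le> real n powr - \<delta>"
    by (simp add: pos_le_divide_eq del: of_nat_Suc)
  moreover have "?N powr (- (1 + \<delta>)) = ?N powr - \<delta> / ?N"
    by (rule powr_neg_one_plus) simp
  ultimately show ?thesis by (simp add: algebra_simps del: of_nat_Suc)
qed

lemma suminf_powr_le:
  fixes \<delta> :: real
  assumes "\<delta> > 0"
  shows "(\<Sum>n. real n powr - (1 + \<delta>)) \<le> 1 + 1 / \<delta>"
proof (rule suminf_le_const)
  show "summable (\<lambda>n. real n powr - (1 + \<delta>))" using assms by (subst summable_real_powr_iff) auto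
  \<comment> \<open>The term at k = 0 is 0, as \<open>0 powr a = 0\<close>, and the term at k = 1 is
    1. Starting at two terms makes the base case an equality; all later terms telescope.\<close>
  have *: "(\<Sum>k<Suc (Suc n). real k powr - (1 + \<delta>)) \<le> 1 + (1 - real (Suc n) powr - \<delta>) / \<delta>" for n
  proof (induction n)
    case (Suc n)
    have "real (Suc (Suc n)) powr - (1 + \<delta>)
        \<le> (real (Suc n) powr - \<delta> - real (Suc (Suc n)) powr - \<delta>) / \<delta>"
      using powr_telescope_bound[OF assms, of "Suc n"] assms
      by (simp add: pos_le_divide_eq mult.commute del: of_nat_Suc)
    then show ?case
      using Suc.IH by (subst sum.lessThan_Suc) (simp add: diff_divide_distrib del: of_nat_Suc sum.lessThan_Suc)
  qed simp
  show "(\<Sum>k<n. real k powr - (1 + \<delta>)) \<le> 1 + 1 / \<delta>" for n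
  proof -
    have "(\<Sum>k<n. real k powr - (1 + \<delta>)) \<le> (\<Sum>k<Suc (Suc n). real k powr - (1 + \<delta>))"
      by (intro sum_mono2) auto
    also have "\<dots> \<le> 1 + (1 - real (Suc n) powr - \<delta>) / \<delta>" by (rule *)
    also have "\<dots> \<le> 1 + 1 / \<delta>" using assms by (simp add: divide_right_mono del: of_nat_Suc)
    finally show ?thesis .
  qed
qed

text \<open>The Euler product as a finite sieve: removing the multiples of one more prime q
  subtracts q^(-s) times the current sum, and so multiplies it by 1 - q^(-s).\<close>

lemma sieved_powr_sums:
  fixes s :: real
  assumes "s > 1" "finite P" "\<And>p. p \<in> P \<Longrightarrow> prime p"
  shows "(\<lambda>n. if \<exists>p\<in>P. p dvd n then 0 else real n powr - s) sums
           ((\<Sum>n. real n powr - s) * (\<Prod>p\<in>P. 1 - real p powr - s))"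
  using assms(2,3)
proof (induction P rule: finite_induct)
  case empty
  have "summable (\<lambda>n. real n powr - s)" using assms(1) by (subst summable_real_powr_iff) auto
  then show ?case by (simp add: summable_sums)
next
  case (insert q P)
  define f where "f = (\<lambda>n. if \<exists>p\<in>P. p dvd n then 0 else real n powr - s)"
  define g where "g = (\<lambda>n. if q dvd n then f n else 0)"
  let ?S = "(\<Sum>n. real n powr - s) * (\<Prod>p\<in>P. 1 - real p powr - s)"
  have q: "prime q" using insert.prems by simp
  have f: "f sums ?S" using insert unfolding f_def by simp
  \<comment> \<open>As q is a prime outside \<open>P\<close>, multiplication by q does not change
    which primes of \<open>P\<close> divide m.\<close>
  have "f (q * m) = real q powr - s * f m" for m
  proof -
    have "p dvd q * m \<longleftrightarrow> p dvd m" if "p \<in> P" for p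
      using that insert.hyps insert.prems q by (metis insertCI prime_dvd_mult_iff primes_dvd_imp_eq)
    then show ?thesis by (auto simp: f_def powr_mult)
  qed
  then have "(\<lambda>m. g (q * m)) sums (real q powr - s * ?S)"
    using sums_mult[OF f] by (simp add: g_def)
  then have "g sums (real q powr - s * ?S)"
    by (subst (asm) sums_mono_reindex)
      (use prime_gt_0_nat[OF q] in \<open>auto simp: strict_mono_def g_def\<close>)
  from sums_diff[OF f this]
  have "(\<lambda>n. f n - g n) sums (?S - real q powr - s * ?S)" .
  moreover have "(\<lambda>n. f n - g n) = (\<lambda>n. if \<exists>p\<in>insert q P. p dvd n then 0 else real n powr - s)"
    by (auto simp: f_def g_def fun_eq_iff)
  moreover have "?S - real q powr - s * ?S
      = (\<Sum>n. real n powr - s) * (\<Prod>p\<in>insert q P. 1 - real p powr - s)"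
    using insert.hyps by (simp add: algebra_simps)
  ultimately show ?case by simp
qed

text \<open>The term n = 1 survives every sieve, so the sieved sum is at least 1; divide by the
  bound \<open>1 + 1 / \<delta>\<close> for the full series.\<close>

lemma prod_one_minus_powr_ge:
  fixes \<delta> :: real
  assumes "\<delta> > 0" "finite P" "\<And>p. p \<in> P \<Longrightarrow> prime p"
  shows "(\<Prod>p\<in>P. 1 - real p powr - (1 + \<delta>)) \<ge> 1 / (1 + 1 / \<delta>)"
proof -
  let ?f = "\<lambda>n. if \<exists>p\<in>P. p dvd n then 0 else real n powr - (1 + \<delta>)"
  have sums: "?f sums ((\<Sum>n. real n powr - (1 + \<delta>)) * (\<Prod>p\<in>P. 1 - real p powr - (1 + \<delta>)))"
    using assms by (intro sieved_powr_sums) auto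
  have "\<not> p dvd 1" if "p \<in> P" for p using assms(3)[OF that] by (simp add: prime_nat_iff)
  then have "1 = sum ?f {1}" by auto
  also have "\<dots> \<le> suminf ?f"
    using sums by (intro sum_le_suminf) (auto simp: sums_iff)
  also have "\<dots> = (\<Sum>n. real n powr - (1 + \<delta>)) * (\<Prod>p\<in>P. 1 - real p powr - (1 + \<delta>))"
    using sums by (simp add: sums_iff)
  also have "\<dots> \<le> (1 + 1 / \<delta>) * (\<Prod>p\<in>P. 1 - real p powr - (1 + \<delta>))"
  proof (intro mult_right_mono suminf_powr_le prod_nonneg)
    show "0 \<le> 1 - real p powr - (1 + \<delta>)" if "p \<in> P" for p
      using powr_mono2'[of "- (1 + \<delta>)" 1 "real p"] prime_ge_1_nat[OF assms(3)[OF that]] assms(1)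
      by (simp del: minus_add_distrib)
  qed fact
  finally show ?thesis using assms(1) by (simp add: field_simps add_pos_pos)
qed

section \<open>Lower bound in Mertens' product theorem\<close>

text \<open>Passing from exponent 1 to 1 + \<delta> raises the Euler factor by (1 - y^(-\<delta>)) /
  y, which is at most \<delta> ln y / y. Since 1 - 1/y \<ge> 1/2, this is a relative increase of at
  most twice that amount, which the exponential absorbs.\<close>

lemma one_minus_inverse_ge:
  fixes y \<delta> :: real
  assumes "y \<ge> 2" "\<delta> > 0"
  shows "1 - 1 / y \<ge> (1 - y powr - (1 + \<delta>)) * exp (- (2 * \<delta> * (ln y / y)))"
proof -
  have "1 - \<delta> * ln y \<le> exp (- \<delta> * ln y)" using exp_ge_add_one_self[of "- \<delta> * ln y"] by simp
  then have "1 - y powr - \<delta> \<le> \<delta> * ln y" using assms by (simp add: powr_def)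
  then have "(1 - y powr - \<delta>) / y \<le> \<delta> * ln y / y" using assms by (intro divide_right_mono) auto
  moreover have "y powr - (1 + \<delta>) = y powr - \<delta> / y"
    using assms by (intro powr_neg_one_plus) simp
  ultimately have 1: "1 - y powr - (1 + \<delta>) \<le> 1 - 1 / y + \<delta> * (ln y / y)"
    by (simp add: diff_divide_distrib)
  have "0 \<le> \<delta> * (ln y / y)" using assms by simp
  moreover have "1 - 1 / y \<ge> 1 / 2" using assms by (simp add: field_simps)
  ultimately have "\<delta> * (ln y / y) \<le> (1 - 1 / y) * (2 * (\<delta> * (ln y / y)))"
    using mult_right_mono[of "1/2" "1 - 1/y" "2 * (\<delta> * (ln y / y))"] by simp
  with 1 have "1 - y powr - (1 + \<delta>) \<le> (1 - 1 / y) * (1 + 2 * \<delta> * (ln y / y))"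
    by (simp add: algebra_simps)
  also have "\<dots> \<le> (1 - 1 / y) * exp (2 * \<delta> * (ln y / y))"
    using assms by (intro mult_left_mono exp_ge_add_one_self) auto
  finally show ?thesis by (simp add: exp_minus field_simps)
qed

lemma mertens_product_ge:
  assumes "n \<ge> 2"
  shows "(\<Prod>p | prime p \<and> p \<le> n. 1 - 1 / real p) \<ge> exp (- 4) / (1 + ln (real n))"
proof -
  let ?P = "{p. prime p \<and> p \<le> n}"
  txt \<open>Rankin's trick: at the exponent \<open>1 + 1 / ln n\<close> the product changes only by
    a bounded factor, and there it is at least the reciprocal of
    \<open>\<zeta>(1 + 1 / ln n) \<le> 1 + ln n\<close>.\<close>
  define \<delta> where "\<delta> = 1 / ln (real n)"
  have \<delta>: "\<delta> > 0" using assms by (simp add: \<delta>_def)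
  have fin: "finite ?P" by (rule finite_subset[of _ "{..n}"]) auto
  have ge2: "real p \<ge> 2" if "p \<in> ?P" for p using that prime_ge_2_nat[of p] by simp
  let ?A = "\<Prod>p\<in>?P. 1 - real p powr - (1 + \<delta>)"
  let ?B = "\<Sum>p\<in>?P. ln (real p) / real p"
  have A: "?A \<ge> 1 / (1 + ln (real n))"
    using prod_one_minus_powr_ge[OF \<delta> fin] by (simp add: \<delta>_def)
  \<comment> \<open>With \<open>\<delta> = 1 / ln n\<close>, the bound \<open>2 * ln n\<close> on
    the sum leaves the constant 2 * 2.\<close>
  have B: "2 * \<delta> * ?B \<le> 4"
    using mult_left_mono[OF sum_ln_prime_over_prime_le[of n], of "2 * \<delta>"] \<delta> assms
    by (simp add: \<delta>_def)
  have "exp (- 4) / (1 + ln (real n)) = 1 / (1 + ln (real n)) * exp (- 4)" by simp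
  also have "\<dots> \<le> ?A * exp (- (2 * \<delta> * ?B))"
    using A B assms by (intro mult_mono) (auto intro: order.trans[rotated])
  also have "\<dots> = (\<Prod>p\<in>?P. (1 - real p powr - (1 + \<delta>)) * exp (- (2 * \<delta> * (ln (real p) / real p))))"
    using fin by (simp add: prod.distrib exp_sum[symmetric] sum_negf sum_distrib_left)
  also have "\<dots> \<le> (\<Prod>p\<in>?P. 1 - 1 / real p)"
  proof (intro prod_mono conjI)
    fix p assume p: "p \<in> ?P"
    show "(1 - real p powr - (1 + \<delta>)) * exp (- (2 * \<delta> * (ln (real p) / real p))) \<le> 1 - 1 / real p"
      using ge2[OF p] \<delta> by (rule one_minus_inverse_ge)
    show "0 \<le> (1 - real p powr - (1 + \<delta>)) * exp (- (2 * \<delta> * (ln (real p) / real p)))"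
      using powr_mono2'[of "- (1 + \<delta>)" 1 "real p"] ge2[OF p] \<delta>
      by (intro mult_nonneg_nonneg) (auto simp del: minus_add_distrib)
  qed
  finally show ?thesis .
qed

section \<open>Moebius sums over the divisors of a squarefree number\<close>

lemma prime_factors_prod_primes:
  fixes P :: "nat set"
  assumes "finite P" "\<And>p. p \<in> P \<Longrightarrow> prime p"
  shows "prime_factors (\<Prod>P) = P"
proof -
  have "prime_factors (\<Prod>P) = \<Union> (prime_factors ` P)"
    using assms by (subst prime_factors_prod) (auto dest: prime_gt_0_nat)
  also have "\<dots> = P" using assms(2) by (force simp: prime_prime_factors)
  finally show ?thesis .
qed

lemma squarefree_prod_primes:
  fixes P :: "nat set"
  assumes "\<And>p. p \<in> P \<Longrightarrow> prime p"
  shows "squarefree (\<Prod>P)"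
  using assms by (intro squarefree_prod_coprime) (simp_all add: primes_coprime squarefree_prime)

lemma prod_prime_factors_squarefree:
  fixes n :: nat
  assumes "squarefree n"
  shows "\<Prod>(prime_factors n) = n"
proof -
  have "n \<noteq> 0" using assms not_squarefree_0 by metis
  then have "n = (\<Prod>p\<in>prime_factors n. p ^ multiplicity p n)"
    by (intro prime_factorization_nat) simp
  also have "\<dots> = \<Prod>(prime_factors n)"
  proof (rule prod.cong[OF refl])
    fix p assume "p \<in> prime_factors n"
    then have "prime p" "multiplicity p n > 0" by (auto simp: prime_factors_multiplicity)
    moreover have "multiplicity p n \<le> 1"
      using assms \<open>n \<noteq> 0\<close> \<open>prime p\<close> squarefree_factorial_semiring''[of n] by simp
    ultimately have "multiplicity p n = 1" by linarith
    then show "p ^ multiplicity p n = p" by simp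
  qed
  finally show ?thesis by (rule sym)
qed

lemma squarefree_dvd_if_primes_dvd:
  fixes d n :: nat
  assumes "squarefree d" "\<And>p. prime p \<Longrightarrow> p dvd d \<Longrightarrow> p dvd n"
  shows "d dvd n"
proof -
  have "\<Prod>(prime_factors d) dvd n"
    using assms(2) by (intro prod_dvd_of_coprime) (auto intro: primes_coprime)
  then show ?thesis using prod_prime_factors_squarefree[OF assms(1)] by simp
qed

text \<open>This turns a divisor sum into a sum over sets of primes, on which the Moebius value
  depends only through the cardinality.\<close>

lemma bij_betw_prod_Pow_prime_factors:
  fixes n :: nat
  assumes "squarefree n"
  shows "bij_betw \<Prod> (Pow (prime_factors n)) {d. d dvd n}"
proof (rule bij_betwI[where g = prime_factors])
  have n: "n \<noteq> 0" using assms not_squarefree_0 by metis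
  show "\<Prod> \<in> Pow (prime_factors n) \<rightarrow> {d. d dvd n}"
    using prod_dvd_prod_subset[of "prime_factors n" _ "\<lambda>p. p"] prod_prime_factors_squarefree[OF assms]
    by auto
  show "prime_factors \<in> {d. d dvd n} \<rightarrow> Pow (prime_factors n)"
    using n dvd_prime_factors by blast
  show "prime_factors (\<Prod>X) = X" if "X \<in> Pow (prime_factors n)" for X
    using that by (intro prime_factors_prod_primes) (auto intro: finite_subset)
  show "\<Prod>(prime_factors d) = d" if "d \<in> {d. d dvd n}" for d
    using that assms squarefree_mono prod_prime_factors_squarefree by auto
qed

lemma sum_moebius_mu_divisors:
  assumes "squarefree n"
  shows "(\<Sum>d | d dvd n. moebius_mu d) = (if n = 1 then 1 else 0)"
proof -
  let ?P = "prime_factors n"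
  have "(\<Sum>d | d dvd n. moebius_mu d) = (\<Sum>X\<in>Pow ?P. moebius_mu (\<Prod>X))"
    using bij_betw_prod_Pow_prime_factors[OF assms] by (simp add: sum.reindex_bij_betw)
  also have "\<dots> = (\<Sum>X\<in>Pow ?P. (- 1) ^ card X)"
  proof (intro sum.cong refl)
    fix X assume X: "X \<in> Pow ?P"
    then have "finite X" "\<And>p. p \<in> X \<Longrightarrow> prime p" by (auto intro: finite_subset)
    then show "moebius_mu (\<Prod>X) = (- 1) ^ card X"
      by (simp add: moebius_mu_def prime_factors_prod_primes squarefree_prod_primes)
  qed
  \<comment> \<open>The alternating sum over subsets is the expansion of a product of factors 1 - 1,
    which vanishes unless the product is empty.\<close>
  also have "\<dots> = (\<Prod>p\<in>?P. 1 - 1)" by (subst prod_diff_conv_sum) auto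
  also have "\<dots> = (if ?P = {} then 1 else 0)" 
    by (cases "?P = {}") (auto simp: card_gt_0_iff)
  also have "?P = {} \<longleftrightarrow> n = 1"
    using prod_prime_factors_squarefree[OF assms] by (metis prod.empty prime_factorization_1 set_mset_empty)
  finally show ?thesis .
qed

section \<open>Ranks of apparition and the counting form of the sum\<close>

lemma apparition_rank_enatD:
  assumes "apparition_rank x d = enat m"
  shows "m \<ge> 1" "d dvd x m"
proof -
  from assms have "\<exists>m\<ge>1. d dvd x m" "m = (LEAST m. m \<ge> 1 \<and> d dvd x m)"
    by (auto simp: apparition_rank_def split: if_splits)
  then show "m \<ge> 1" "d dvd x m" by (metis (mono_tags, lifting) LeastI_ex)+
qed

text \<open>If d divides \<open>x n\<close>, then it divides
  \<open>gcd (x n) (x m) = x (gcd n m)\<close> for its rank m, and minimality of m forces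
  \<open>gcd n m = m\<close>. Conversely, m dvd n makes \<open>x m\<close> a divisor of
  \<open>x n\<close>.\<close>

lemma dvd_iff_apparition_rank_dvd:
  assumes "strong_divisibility_sequence x" "n \<ge> 1"
  shows "d dvd x n \<longleftrightarrow> (\<exists>m. apparition_rank x d = enat m \<and> m dvd n)"
proof (intro iffI)
  assume d: "d dvd x n"
  define m where "m = (LEAST m. m \<ge> 1 \<and> d dvd x m)"
  have rank: "apparition_rank x d = enat m"
    using d assms(2) by (auto simp: apparition_rank_def m_def)
  note m = apparition_rank_enatD[OF rank]
  have "gcd (x n) (x m) = x (gcd n m)"
    using assms m(1) by (simp add: strong_divisibility_sequence_def)
  then have "d dvd x (gcd n m)" using d m(2) by (metis gcd_greatest)
  moreover have "gcd n m \<ge> 1" using m(1) by (simp add: Suc_le_eq)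
  ultimately have "m \<le> gcd n m" unfolding m_def by (intro Least_le) simp
  then have "gcd n m = m" using m(1) by (intro antisym gcd_le2_nat) auto
  then have "m dvd n" by (metis gcd_dvd1)
  with rank show "\<exists>m. apparition_rank x d = enat m \<and> m dvd n" by blast
next
  assume "\<exists>m. apparition_rank x d = enat m \<and> m dvd n"
  then obtain m where rank: "apparition_rank x d = enat m" and "m dvd n" by blast
  note m = apparition_rank_enatD[OF rank]
  have "gcd (x n) (x m) = x (gcd n m)"
    using assms m(1) by (simp add: strong_divisibility_sequence_def)
  also have "gcd n m = m" using \<open>m dvd n\<close> by (simp add: gcd_nat.absorb2)
  finally have "x m dvd x n" by (metis gcd_dvd1)
  with m(2) show "d dvd x n" by (rule dvd_trans)
qed

lemma card_multiples_upto:
  fixes m N :: nat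
  assumes "m > 0"
  shows "card {n \<in> {0<..N}. m dvd n} = N div m"
proof -
  have "{n \<in> {0<..N}. m dvd n} = (*) m ` {0<..N div m}"
    using assms by (auto simp: less_eq_div_iff_mult_less_eq mult.commute elim: dvdE)
  then show ?thesis using assms by (simp add: card_image inj_on_def)
qed

text \<open>N is a common multiple of the finite ranks of the primes dividing Q, hence of all finite
  ranks m of divisors d of Q. Thus N / m counts exactly the n up to N with d dvd \<open>x n\<close>;
  exchanging the sums leaves a Moebius sum over the common divisors of Q and
  \<open>x n\<close>.\<close>

lemma sum_moebius_over_rank_eq_card:
  assumes sds: "strong_divisibility_sequence x" and Q: "squarefree Q" and "N > 0"
    and N: "\<And>p m. prime p \<Longrightarrow> p dvd Q \<Longrightarrow> apparition_rank x p = enat m \<Longrightarrow> m dvd N"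
  shows "real N * (\<Sum>d | d dvd Q. moebius_over_rank x d) = real (card {n \<in> {0<..N}. coprime Q (x n)})"
proof -
  have fin: "finite {d. d dvd Q}" using Q by (intro finite_divisors_nat) (auto intro: Nat.gr0I)
  have term_eq: "real N * moebius_over_rank x d
      = (\<Sum>n\<in>{0<..N}. if d dvd x n then real_of_int (moebius_mu d) else 0)" if "d dvd Q" for d
  proof (cases "apparition_rank x d")
    case (enat m)
    note m = apparition_rank_enatD[OF enat]
    \<comment> \<open>This yields m dvd N by the rank criterion. As d is squarefree, it can be
      checked one prime at a time, where the hypothesis on N applies.\<close>
    have "d dvd x N"
    proof (rule squarefree_dvd_if_primes_dvd)
      show "squarefree d" using Q that by (rule squarefree_mono[rotated])
      show "p dvd x N" if p: "prime p" "p dvd d" for p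
      proof -
        have "p dvd x m" using p m dvd_trans by blast
        then obtain k where "apparition_rank x p = enat k"
          using dvd_iff_apparition_rank_dvd[OF sds m(1)] by blast
        moreover from this have "k dvd N" using N p \<open>d dvd Q\<close> dvd_trans by blast
        ultimately show ?thesis
          using dvd_iff_apparition_rank_dvd[OF sds, of N p] \<open>N > 0\<close> by auto
      qed
    qed
    then have "m dvd N" using dvd_iff_apparition_rank_dvd[OF sds, of N d] \<open>N > 0\<close> enat by simp
    have "{n \<in> {0<..N}. d dvd x n} = {n \<in> {0<..N}. m dvd n}"
      using dvd_iff_apparition_rank_dvd[OF sds, of _ d] enat by auto
    then have "card {n \<in> {0<..N}. d dvd x n} = N div m" using card_multiples_upto m(1) by simp
    then have "(\<Sum>n\<in>{0<..N}. if d dvd x n then real_of_int (moebius_mu d) else 0)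
        = real (N div m) * real_of_int (moebius_mu d)"
      by (simp add: sum.inter_filter[symmetric])
    then show ?thesis using \<open>m dvd N\<close> by (simp add: moebius_over_rank_def enat real_of_nat_div)
  next
    case infinity
    then have "\<not> d dvd x n" if "n \<in> {0<..N}" for n
      using dvd_iff_apparition_rank_dvd[OF sds, of n d] that by simp
    then show ?thesis by (simp add: moebius_over_rank_def infinity)
  qed
  have "real N * (\<Sum>d | d dvd Q. moebius_over_rank x d)
      = (\<Sum>n\<in>{0<..N}. \<Sum>d | d dvd Q. if d dvd x n then real_of_int (moebius_mu d) else 0)"
    by (subst sum.swap) (simp add: sum_distrib_left term_eq)
  also have "\<dots> = (\<Sum>n\<in>{0<..N}. if coprime Q (x n) then 1 else 0)"
  proof (rule sum.cong[OF refl])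
    fix n
    have "(\<Sum>d | d dvd Q. if d dvd x n then real_of_int (moebius_mu d) else 0)
        = real_of_int (\<Sum>d | d dvd gcd Q (x n). moebius_mu d)"
      using fin by (simp add: sum.inter_filter[symmetric])
    also have "\<dots> = (if coprime Q (x n) then 1 else 0)"
      unfolding sum_moebius_mu_divisors[OF squarefree_mono[OF gcd_dvd1 Q]] coprime_iff_gcd_eq_1
      by (simp only: of_int_1 of_int_0 split: if_split) simp
    finally show "(\<Sum>d | d dvd Q. if d dvd x n then real_of_int (moebius_mu d) else 0)
        = (if coprime Q (x n) then 1 else 0)" .
  qed
  also have "\<dots> = real (card {n \<in> {0<..N}. coprime Q (x n)})"
    by (simp add: sum.inter_filter[symmetric])
  finally show ?thesis .
qed

lemma sum_moebius_over_rank_ge: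
  assumes sds: "strong_divisibility_sequence x" and x1: "x 1 = 1" and Q: "squarefree Q" and "Y \<ge> 2"
    and Y: "\<And>p m. prime p \<Longrightarrow> p dvd Q \<Longrightarrow> apparition_rank x p = enat m \<Longrightarrow> m \<le> Y"
  shows "(\<Sum>d | d dvd Q. moebius_over_rank x d) \<ge> exp (- 4) / (1 + ln (real Y))"
proof -
  txt \<open>Every finite \<open>m\<^sub>p\<close> with \<open>p dvd Q\<close> divides \<open>fact Y\<close>, so \<open>fact Y\<close> is a common period whose prime
    factors are exactly the primes up to \<open>Y\<close>.\<close>
  let ?N = "fact Y :: nat"
  have N: "m dvd ?N" if "prime p" "p dvd Q" "apparition_rank x p = enat m" for p m
    using Y[OF that] apparition_rank_enatD(1)[OF that(3)] by (intro dvd_fact)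
  \<comment> \<open>A common prime p of Q and \<open>x n\<close> would have a rank dividing both n
    and \<open>fact Y\<close>, hence equal to 1, against \<open>x 1 = 1\<close>.\<close>
  have "coprime Q (x n)" if n: "n \<in> totatives ?N" for n
  proof (rule ccontr)
    assume "\<not> coprime Q (x n)"
    then obtain p where p: "prime p" "p dvd Q" "p dvd x n"
      by (metis coprime_iff_gcd_eq_1 gcd_nat.boundedE prime_factor_nat)
    have "n \<ge> 1" using n by (simp add: in_totatives_iff)
    then obtain m where m: "apparition_rank x p = enat m" "m dvd n"
      using dvd_iff_apparition_rank_dvd[OF sds] p(3) by blast
    have "m = 1"
      using n m N[OF p(1,2)] coprime_common_divisor_nat[of n ?N m] by (simp add: in_totatives_iff)
    then have "p dvd 1" using apparition_rank_enatD(2)[OF m(1)] x1 by simp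
    with p(1) show False by (simp add: prime_nat_iff)
  qed
  then have "totatives ?N \<subseteq> {n \<in> {0<..?N}. coprime Q (x n)}"
    by (auto simp: in_totatives_iff)
  then have "totient ?N \<le> card {n \<in> {0<..?N}. coprime Q (x n)}"
    unfolding totient_def by (intro card_mono) auto
  then have "real (totient ?N) \<le> real ?N * (\<Sum>d | d dvd Q. moebius_over_rank x d)"
    using sum_moebius_over_rank_eq_card[OF sds Q, of ?N] N by simp
  moreover have "prime_factors ?N = {p. prime p \<and> p \<le> Y}"
    by (auto simp: in_prime_factors_iff prime_dvd_fact_iff)
  then have "real (totient ?N) = real ?N * (\<Prod>p | prime p \<and> p \<le> Y. 1 - 1 / real p)"
    by (simp add: totient_formula2)
  ultimately have "(\<Prod>p | prime p \<and> p \<le> Y. 1 - 1 / real p) \<le> (\<Sum>d | d dvd Q. moebius_over_rank x d)"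
    by simp
  with mertens_product_ge[OF \<open>Y \<ge> 2\<close>] show ?thesis by linarith
qed

section \<open>Choice of the cutoff and of the constant\<close>

theorem theorem1p7:
  fixes x :: "nat \<Rightarrow> nat" and \<alpha> :: real
  assumes "strong_divisibility_sequence x"
    and "x 1 = 1"
    and "\<alpha> > 0"
    and "finite {p :: nat. prime p \<and>
           \<not> ereal_of_enat (apparition_rank x p) < ereal (real p powr \<alpha>)}"
  shows "\<exists>c::real. c > 0 \<and>
           (\<forall>z::real. z \<ge> 2 \<longrightarrow>
              (\<Sum>d | d dvd primorial_below z. moebius_over_rank x d) \<ge> c / ln z)"
proof -
  define E where "E = {p :: nat. prime p \<and>
           \<not> ereal_of_enat (apparition_rank x p) < ereal (real p powr \<alpha>)}"
  \<comment> \<open>K bounds every finite rank of an exceptional prime. Exceptional primes of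
    infinite rank add an unspecified natural number, which can only enlarge K; the summand 2 ensures
    \<open>Y \<ge> 2\<close> below.\<close>
  define K where "K = 2 + (\<Sum>p\<in>E. the_enat (apparition_rank x p))"
  \<comment> \<open>Chosen so that 1 + ln (2 K z^\<alpha>) \<le> C ln z for all z \<ge> 2: the
    constant part is absorbed using ln z / ln 2 \<ge> 1.\<close>
  define C where "C = (1 + ln (2 * real K)) / ln 2 + \<alpha>"
  have "finite E" using assms(4) by (simp add: E_def)
  have K: "K \<ge> 2" by (simp add: K_def)
  have "0 \<le> ln (2 * real K)" using K by simp
  then have "C > 0" using assms(3) by (simp add: C_def add_nonneg_pos)
  have "(\<Sum>d | d dvd primorial_below z. moebius_over_rank x d) \<ge> exp (- 4) / C / ln z"
    if z: "z \<ge> 2" for z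
  proof -
    let ?P = "{p :: nat. prime p \<and> real p < z}"
    \<comment> \<open>The first summand covers the exceptional primes, the second all other primes
      below z.\<close>
    define Y where "Y = K + nat \<lfloor>z powr \<alpha>\<rfloor>"
    have fin: "finite ?P"
      by (rule finite_subset[of _ "{..nat \<lceil>z\<rceil>}"]) (auto simp: le_nat_iff intro: less_imp_le, linarith)
    have za: "z powr \<alpha> \<ge> 1" using z assms(3) by (simp add: ge_one_powr_ge_zero)
    have rank_le: "m \<le> Y"
      if p: "prime p" "p dvd primorial_below z" and m: "apparition_rank x p = enat m" for p m
    proof (cases "p \<in> E")
      case True
      then have "the_enat (apparition_rank x p) \<le> (\<Sum>p\<in>E. the_enat (apparition_rank x p))"
        using \<open>finite E\<close> by (intro member_le_sum) auto
      then show ?thesis by (simp add: m Y_def K_def)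
    next
      case False
      have "p \<in> prime_factors (primorial_below z)"
        using p fin by (auto simp: in_prime_factors_iff primorial_below_def dest: prime_gt_0_nat)
      then have "real p < z"
        using prime_factors_prod_primes[OF fin] by (simp add: primorial_below_def)
      have "real m < real p powr \<alpha>" using False p(1) m by (simp add: E_def)
      also have "\<dots> \<le> z powr \<alpha>" using \<open>real p < z\<close> assms(3) by (intro powr_mono2) auto
      finally show ?thesis by (simp add: Y_def) linarith
    qed
    have "Y \<ge> 2" using K by (simp add: Y_def)
    have "real Y \<le> real K + z powr \<alpha>" using za by (simp add: Y_def)
    \<comment> \<open>Both K and z^\<alpha> are at least 1, so each is at most their product; the
      logarithm of the product then splits.\<close>
    also have "\<dots> \<le> 2 * real K * z powr \<alpha>"
    proof -
      have "real K * 1 \<le> real K * z powr \<alpha>" using za by (intro mult_left_mono) auto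
      moreover have "1 * z powr \<alpha> \<le> real K * z powr \<alpha>" using K by (intro mult_right_mono) auto
      ultimately show ?thesis by simp
    qed
    finally have "ln (real Y) \<le> ln (2 * real K * z powr \<alpha>)" using \<open>Y \<ge> 2\<close> by (intro ln_mono) auto
    also have "\<dots> = ln (2 * real K) + \<alpha> * ln z" using K z by (subst ln_mult) (auto simp: ln_powr)
    finally have "1 + ln (real Y) \<le> (1 + ln (2 * real K)) * 1 + \<alpha> * ln z" by simp
    also have "\<dots> \<le> (1 + ln (2 * real K)) * (ln z / ln 2) + \<alpha> * ln z"
      using z \<open>0 \<le> ln (2 * real K)\<close> by (intro add_right_mono mult_left_mono) auto
    also have "\<dots> = C * ln z" by (simp add: C_def algebra_simps add_divide_distrib)
    finally have "1 + ln (real Y) \<le> C * ln z" .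
    moreover have "0 < 1 + ln (real Y)" using \<open>Y \<ge> 2\<close> by (intro add_pos_nonneg) auto
    ultimately have "exp (- 4) / (C * ln z) \<le> exp (- 4) / (1 + ln (real Y))"
      by (intro frac_le) auto
    also have "\<dots> \<le> (\<Sum>d | d dvd primorial_below z. moebius_over_rank x d)"
    proof (rule sum_moebius_over_rank_ge[OF assms(1,2) _ \<open>Y \<ge> 2\<close> rank_le])
      show "squarefree (primorial_below z)"
        unfolding primorial_below_def by (rule squarefree_prod_primes) simp
    qed
    finally show ?thesis by simp
  qed
  with \<open>C > 0\<close> show ?thesis by (intro exI[of _ "exp (- 4) / C"]) auto
qed

end
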